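(* Let $P\subseteq\mathbb{R}^2$ be a convex polygon with boundary $\partial P$, and let $u,v,w\in P$ be pairwise distinct. Consider the Voronoi cells $\mathrm{Vor}(u),\mathrm{Vor}(v),\mathrm{Vor}(w)$ with respect to the point set $\{u,v,w\}$. If there are points $a,b_1,c,b_2\in\partial P$ appearing in this cyclic order along $\partial P$ such that $a\in\mathrm{Vor}(u)$, $b_1,b_2\in\mathrm{Vor}(v)$ and $c\in\mathrm{Vor}(w)$, then the angle $\angle uvw$ is at least $90^\circ$.
   Context: For a finite point set $Q\subseteq\mathbb{R}^2$ and $p\in Q$, the Voronoi cell $\mathrm{Vor}(p)$ consists of all points $x\in\mathbb{R}^2$ such that no point of $Q$ is strictly closer to $x$ than $p$. *)

theory Defs
  imports "HOL-Analysis.Analysis"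
begin

text \<open>Polygons are full-dimensional: segments and points are excluded, so that the
  frontier is a simple closed curve.\<close>

definition convex_polygon :: "(real ^ 2) set \<Rightarrow> bool" where
  "convex_polygon P \<longleftrightarrow> polytope P \<and> interior P \<noteq> {}"

definition Vor :: "(real ^ 2) set \<Rightarrow> real ^ 2 \<Rightarrow> (real ^ 2) set" where
  "Vor Q p = {x. \<not> (\<exists>q\<in>Q. dist x q < dist x p)}"

text \<open>A closed traversal of \<open>C\<close> meets the four (necessarily distinct) points in the listed
  order. Starting point and orientation of the traversal are free, so the notion is invariant
  under rotating and reversing the list.\<close>

definition in_cyclic_order ::
  "(real ^ 2) set \<Rightarrow> real ^ 2 \<Rightarrow> real ^ 2 \<Rightarrow> real ^ 2 \<Rightarrow> real ^ 2 \<Rightarrow> bool" where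
  "in_cyclic_order C p\<^sub>1 p\<^sub>2 p\<^sub>3 p\<^sub>4 \<longleftrightarrow>
     (\<exists>g t\<^sub>1 t\<^sub>2 t\<^sub>3 t\<^sub>4. simple_path g \<and> pathfinish g = pathstart g \<and> path_image g = C \<and>
        0 \<le> t\<^sub>1 \<and> t\<^sub>1 < t\<^sub>2 \<and> t\<^sub>2 < t\<^sub>3 \<and> t\<^sub>3 < t\<^sub>4 \<and> t\<^sub>4 < 1 \<and>
        g t\<^sub>1 = p\<^sub>1 \<and> g t\<^sub>2 = p\<^sub>2 \<and> g t\<^sub>3 = p\<^sub>3 \<and> g t\<^sub>4 = p\<^sub>4)"

text \<open>The unoriented angle at the middle argument, in \<open>[0, pi]\<close>; meaningful when
  the middle argument differs from the other two.\<close>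

definition angle :: "real ^ 2 \<Rightarrow> real ^ 2 \<Rightarrow> real ^ 2 \<Rightarrow> real" where
  "angle u v w = arccos (((u - v) \<bullet> (w - v)) / (norm (u - v) * norm (w - v)))"

end

theory Submission
  imports Defs
begin

text \<open>If the angle at \<open>v\<close> were acute, no point of the segment \<open>u w\<close> would lie in \<open>Vor v\<close>, so the
  polyline \<open>a u w c\<close> inside \<open>P\<close> would meet \<open>Vor v\<close> at most in its endpoints. The chord \<open>b\<^sub>1 b\<^sub>2\<close> lies in
  \<open>Vor v\<close> and, by the cyclic order, either separates \<open>a\<close> from \<open>c\<close> in \<open>P\<close>, so the polyline crosses it,
  or it lies on an edge of \<open>P\<close> and contains, say, \<open>a\<close>. In the latter case the edge spans the bisector
  of \<open>u\<close> and \<open>v\<close>, although \<open>P\<close> lies on one side of it. The separation comes from projecting the plane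
  radially from an interior point \<open>p\<close> onto the frontier: the complement of the cone spanned by the
  chord is connected, so \<open>a\<close> and \<open>c\<close> cannot both lie outside that cone.\<close>

section \<open>Radial projection onto the frontier of a convex body\<close>

text \<open>Each ray from \<open>p\<close> meets the frontier exactly once, so the frontier is
  parametrised continuously by directions. As \<open>S\<close> consists of whole open rays, its
  trace on the frontier is the continuous image of its connected set of directions.\<close>

lemma connected_frontier_Int_cone:
  fixes P S :: "'a::euclidean_space set"
  assumes "convex P" "compact P" and p: "p \<in> interior P"
    and "connected S" "p \<notin> S"
    and cone: "\<And>x s. x \<in> S \<Longrightarrow> s > 0 \<Longrightarrow> p + s *\<^sub>R (x - p) \<in> S"
  shows "connected (frontier P \<inter> S)"
proof -
  define n where "n x = sgn (x - p)" for x
  have pfr: "p \<notin> frontier P" using p by (simp add: frontier_def)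
  have cf: "compact (frontier P)" using assms(2) by (rule compact_frontier)
  have bnd: "bounded P" using assms(2) compact_imp_bounded by blast
  have cn: "continuous_on (- {p}) n"
    unfolding n_def sgn_div_norm by (intro continuous_intros) auto
  have cnf: "continuous_on (frontier P) n"
    using cn pfr by (blast intro: continuous_on_subset)
  \<comment> \<open>Of two distinct frontier points on one ray, the nearer lies strictly between the
    interior point \<open>p\<close> and the farther, hence is interior.\<close>
  have key: "x = y" if x: "x \<in> frontier P" and y: "y \<in> frontier P" and eq: "n x = n y"
    and le: "norm (x - p) \<le> norm (y - p)" for x y
  proof (rule ccontr)
    assume "x \<noteq> y"
    have xp: "x \<noteq> p" "y \<noteq> p" using x y pfr by auto
    have x_eq: "x - p = norm (x - p) *\<^sub>R n x" for x
      by (cases "x = p") (simp_all add: n_def sgn_div_norm)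
    have "norm (x - p) \<noteq> norm (y - p)"
      using x_eq[of x] x_eq[of y] eq \<open>x \<noteq> y\<close> by (metis diff_add_cancel)
    with le have lt: "norm (x - p) < norm (y - p)" by simp
    define e where "e = 1 - norm (x - p) / norm (y - p)"
    have e: "0 < e" "e \<le> 1" using lt xp by (auto simp: e_def)
    have "(1 - e) *\<^sub>R (y - p) = norm (x - p) *\<^sub>R n x"
      using xp by (subst x_eq[of y]) (simp add: e_def eq)
    then have "x = y - e *\<^sub>R (y - p)"
      using x_eq[of x] by (simp add: algebra_simps)
    moreover have "y \<in> closure P" using y by (simp add: frontier_def)
    ultimately have "x \<in> interior P"
      using mem_interior_closure_convex_shrink[OF assms(1) p, of y e] e by simp
    then show False using x by (simp add: frontier_def)
  qed
  have inj: "inj_on n (frontier P)"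
    by (rule inj_onI) (metis key linear)
  \<comment> \<open>\<open>h\<close> returns the frontier point in a given direction; compactness of
    the frontier makes this inverse continuous.\<close>
  define h where "h = inv_into (frontier P) n"
  have ch: "continuous_on (n ` frontier P) h"
    unfolding h_def using cnf cf inj
    by (intro continuous_on_inv) (auto simp: inj)
  have surj: "n x \<in> n ` frontier P" if "x \<noteq> p" for x
  proof -
    have "x - p \<noteq> 0" using that by simp
    obtain d where d: "0 < d" "p + d *\<^sub>R (x - p) \<in> frontier P"
      using ray_to_frontier[OF bnd p \<open>x - p \<noteq> 0\<close>] by blast
    have "n (p + d *\<^sub>R (x - p)) = n x" using d by (simp add: n_def sgn_scaleR)
    then show ?thesis using d by (metis imageI)
  qed
  have sub: "n ` S \<subseteq> n ` frontier P" using surj \<open>p \<notin> S\<close> by (metis image_subsetI)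
  have ncone: "y \<in> S" if "x \<in> S" "y \<noteq> p" "n x = n y" for x y
  proof -
    have "x \<noteq> p" using that assms by auto
    have "y - p = norm (y - p) *\<^sub>R n x" using that by (simp add: n_def sgn_div_norm)
    also have "\<dots> = (norm (y - p) / norm (x - p)) *\<^sub>R (x - p)"
      by (simp add: n_def sgn_div_norm divide_inverse)
    finally have "y = p + (norm (y - p) / norm (x - p)) *\<^sub>R (x - p)" by (simp add: algebra_simps)
    moreover have "norm (y - p) / norm (x - p) > 0" using that \<open>x \<noteq> p\<close> by simp
    ultimately show ?thesis using cone[OF \<open>x \<in> S\<close>] by metis
  qed
  have "frontier P \<inter> S = h ` n ` S"
  proof (intro equalityI subsetI)
    fix y assume "y \<in> frontier P \<inter> S"
    then show "y \<in> h ` n ` S" by (metis Int_iff h_def image_eqI inj inv_into_f_f)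
  next
    fix y assume "y \<in> h ` n ` S"
    then obtain x where x: "x \<in> S" "y = h (n x)" by blast
    then have "n x \<in> n ` frontier P" using sub by blast
    then have "y \<in> frontier P" "n y = n x"
      using x by (auto simp: h_def inv_into_into f_inv_into_f)
    then show "y \<in> frontier P \<inter> S" using ncone[OF x(1)] pfr by (metis IntI)
  qed
  moreover have "connected (n ` S)"
    using assms(4,5) by (intro connected_continuous_image continuous_on_subset[OF cn]) auto
  ultimately show ?thesis
    using ch sub by (metis connected_continuous_image continuous_on_subset)
qed

section \<open>Cyclic order and the cone over a chord\<close>

text \<open>The points \<open>g t2\<close> and \<open>g t4\<close> cut the curve into two closed
  arcs \<open>A\<close> and \<open>B\<close> sharing only these points; off them, the arcs would
  disconnect \<open>T\<close>, with \<open>g t1\<close> and \<open>g t3\<close> in different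
  pieces.\<close>

lemma simple_closed_path_separation:
  fixes g :: "real \<Rightarrow> 'a::t2_space"
  assumes g: "simple_path g" "pathfinish g = pathstart g"
    and t: "0 \<le> t1" "t1 < t2" "t2 < t3" "t3 < t4" "t4 < 1"
    and T: "connected T" "T \<subseteq> path_image g - {g t2, g t4}" "g t1 \<in> T" "g t3 \<in> T"
  shows False
proof -
  define A where "A = g ` {t2..t4}"
  define B where "B = g ` ({0..t2} \<union> {t4..1})"
  have cg: "continuous_on {0..1} g" using g by (simp add: simple_path_def path_def)
  have inj: "x = y \<or> x = 0 \<and> y = 1 \<or> x = 1 \<and> y = 0"
    if "g x = g y" "x \<in> {0..1}" "y \<in> {0..1}" for x y
    using g that unfolding simple_path_def loop_free_def by blast
  have "closed A" unfolding A_def using t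
    by (intro compact_imp_closed compact_continuous_image continuous_on_subset[OF cg]) auto
  moreover have "closed B" unfolding B_def using t
    by (intro compact_imp_closed compact_continuous_image continuous_on_subset[OF cg]) auto
  moreover have "T \<subseteq> A \<union> B"
    using T(2) t unfolding A_def B_def path_image_def by (force simp: image_iff)
  moreover have "A \<inter> B \<inter> T = {}"
  proof -
    \<comment> \<open>The interval from \<open>t2\<close> to \<open>t4\<close> avoids 0 and 1, so
      the base point exception in \<open>inj\<close> cannot occur.\<close>
    have "g x \<in> {g t2, g t4}" if "g x = g y" "x \<in> {t2..t4}" "y \<in> {0..t2} \<union> {t4..1}" for x y
      using inj[of x y] that t by auto
    then have "A \<inter> B \<subseteq> {g t2, g t4}" unfolding A_def B_def by blast
    then show ?thesis using T by blast
  qed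
  moreover have "g t1 \<in> B \<inter> T" using t T by (auto simp: B_def)
  moreover have "g t3 \<in> A \<inter> T" using t T by (auto simp: A_def)
  ultimately show False using T(1) unfolding connected_closed by blast
qed

text \<open>The complement is star-shaped about a point opposite to the cone. Keeping
  \<open>p\<close> off the open segment prevents the two rays from forming a full line, whose
  complement in the plane is disconnected.\<close>

lemma connected_Compl_cone2:
  fixes p x y :: "'a::real_normed_vector"
  assumes "p \<notin> open_segment x y" "x \<noteq> p" "y \<noteq> p" "x \<noteq> y"
  defines "K \<equiv> {p + \<alpha> *\<^sub>R (x - p) + \<beta> *\<^sub>R (y - p) |\<alpha> \<beta>. 0 \<le> \<alpha> \<and> 0 \<le> \<beta>}"
  shows "connected (- K)"
proof (rule starlike_imp_connected)
  \<comment> \<open>The reflection in \<open>p\<close> of the cone point with both coefficients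
    1.\<close>
  define d where "d = p - ((x - p) + (y - p))"
  have dK: "d \<notin> K"
  proof
    assume "d \<in> K"
    then obtain \<alpha> \<beta> where ab: "0 \<le> \<alpha>" "0 \<le> \<beta>" "d = p + \<alpha> *\<^sub>R (x - p) + \<beta> *\<^sub>R (y - p)"
      unfolding K_def by blast
    define s where "s = (1 + \<beta>) / (2 + \<alpha> + \<beta>)"
    have s: "0 < s" "s < 1" "1 - s = (1 + \<alpha>) / (2 + \<alpha> + \<beta>)"
      using ab by (auto simp: s_def field_simps)
    \<comment> \<open>A positive combination that vanishes; dividing by the total weight puts
      \<open>p\<close> on the open segment.\<close>
    have "(1 + \<alpha>) *\<^sub>R (x - p) + (1 + \<beta>) *\<^sub>R (y - p) = 0"
      using ab(3) unfolding d_def by (simp add: algebra_simps)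
    then have "(1 / (2 + \<alpha> + \<beta>)) *\<^sub>R ((1 + \<alpha>) *\<^sub>R (x - p) + (1 + \<beta>) *\<^sub>R (y - p)) = 0" by simp
    then have "(1 - s) *\<^sub>R (x - p) + s *\<^sub>R (y - p) = 0"
      unfolding s(3) unfolding s_def by (simp add: scaleR_add_right)
    then have "p = (1 - s) *\<^sub>R x + s *\<^sub>R y" by (simp add: algebra_simps)
    then show False using assms s unfolding in_segment by blast
  qed
  have "closed_segment d z \<subseteq> - K" if "z \<notin> K" for z
  proof
    fix q assume "q \<in> closed_segment d z"
    then obtain t where t: "0 \<le> t" "t \<le> 1" "q = (1 - t) *\<^sub>R d + t *\<^sub>R z"
      unfolding in_segment by blast
    show "q \<in> - K"
    proof
      assume "q \<in> K"
      then obtain \<alpha> \<beta> where ab: "0 \<le> \<alpha>" "0 \<le> \<beta>" "q = p + \<alpha> *\<^sub>R (x - p) + \<beta> *\<^sub>R (y - p)"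
        unfolding K_def by blast
      show False
      proof (cases "t = 0")
        case True
        then show False using \<open>q \<in> K\<close> dK t by simp
      next
        case False
        \<comment> \<open>Solving for \<open>z\<close> only adds the nonnegative amount
          \<open>1 - t\<close> to both coefficients of \<open>q\<close>, so \<open>z\<close> would
          lie in the cone as well.\<close>
        have "t *\<^sub>R (z - p) = (\<alpha> + (1 - t)) *\<^sub>R (x - p) + (\<beta> + (1 - t)) *\<^sub>R (y - p)"
          using ab(3) t(3) unfolding d_def by (simp add: algebra_simps)
        then have "(1 / t) *\<^sub>R (t *\<^sub>R (z - p)) =
            ((\<alpha> + (1 - t)) / t) *\<^sub>R (x - p) + ((\<beta> + (1 - t)) / t) *\<^sub>R (y - p)"
          by (simp add: scaleR_add_right)
        then have "z = p + ((\<alpha> + (1 - t)) / t) *\<^sub>R (x - p) + ((\<beta> + (1 - t)) / t) *\<^sub>R (y - p)"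
          using False by (simp add: algebra_simps)
        moreover have "0 \<le> (\<alpha> + (1 - t)) / t" "0 \<le> (\<beta> + (1 - t)) / t" using ab t by auto
        ultimately show False using that unfolding K_def by blast
      qed
    qed
  qed
  then show "starlike (- K)" using dK unfolding starlike_def by blast
qed

text \<open>If \<open>a\<close> and \<open>c\<close> both avoided the cone at \<open>p\<close> over
  the chord, the frontier outside the cone would be a connected set joining them without
  \<open>x\<close> and \<open>y\<close>, against the cyclic order. A coefficient sum below 1 would
  place the point strictly on the near side of the chord, hence in the interior.\<close>

lemma cyclic_order_beyond_chord:
  fixes P :: "(real^2) set"
  assumes P: "convex P" "compact P" and p: "p \<in> interior P"
    and pb: "p \<notin> closed_segment x y"
    and ord: "in_cyclic_order (frontier P) a x c y"
  shows "\<exists>z\<in>{a, c}. \<exists>\<alpha> \<beta>. 0 \<le> \<alpha> \<and> 0 \<le> \<beta> \<and> 1 \<le> \<alpha> + \<beta> \<and>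
    z = p + \<alpha> *\<^sub>R (x - p) + \<beta> *\<^sub>R (y - p)"
proof -
  obtain g t1 t2 t3 t4 where g: "simple_path g" "pathfinish g = pathstart g"
    "path_image g = frontier P" and t: "0 \<le> t1" "t1 < t2" "t2 < t3" "t3 < t4" "t4 < 1"
    and gt: "g t1 = a" "g t2 = x" "g t3 = c" "g t4 = y"
    using ord unfolding in_cyclic_order_def by blast
  have fr: "a \<in> frontier P" "x \<in> frontier P" "c \<in> frontier P" "y \<in> frontier P"
    using g(3) t gt unfolding path_image_def by force+
  have xy: "x \<noteq> y"
    using g(1) t gt unfolding simple_path_def loop_free_def by force
  have inP: "z \<in> P" if "z \<in> frontier P" for z
    using that P(2) by (metis compact_imp_closed frontier_subset_closed subsetD)
  define K where "K = {p + \<alpha> *\<^sub>R (x - p) + \<beta> *\<^sub>R (y - p) |\<alpha> \<beta>. 0 \<le> \<alpha> \<and> 0 \<le> \<beta>}"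
  have "a \<in> K \<or> c \<in> K"
  proof (rule ccontr)
    assume nK: "\<not> (a \<in> K \<or> c \<in> K)"
    have "connected (- K)" unfolding K_def
      using pb xy by (intro connected_Compl_cone2) (auto simp: open_segment_def)
    moreover have "p = p + 0 *\<^sub>R (x - p) + 0 *\<^sub>R (y - p)" by simp
    then have "p \<in> K" unfolding K_def by blast
    moreover have "p + s *\<^sub>R (z - p) \<in> - K" if z: "z \<in> - K" and s: "s > 0" for z s
    proof
      assume "p + s *\<^sub>R (z - p) \<in> K"
      then obtain \<alpha> \<beta> where ab: "0 \<le> \<alpha>" "0 \<le> \<beta>"
        "s *\<^sub>R (z - p) = \<alpha> *\<^sub>R (x - p) + \<beta> *\<^sub>R (y - p)"
        unfolding K_def by (auto simp: algebra_simps)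
      have "(1 / s) *\<^sub>R (s *\<^sub>R (z - p)) = (\<alpha> / s) *\<^sub>R (x - p) + (\<beta> / s) *\<^sub>R (y - p)"
        unfolding ab(3) by (simp add: scaleR_add_right)
      then have "z = p + (\<alpha> / s) *\<^sub>R (x - p) + (\<beta> / s) *\<^sub>R (y - p)"
        using s by (simp add: algebra_simps)
      moreover have "0 \<le> \<alpha> / s" "0 \<le> \<beta> / s" using ab s by auto
      ultimately show False using z unfolding K_def by blast
    qed
    ultimately have "connected (frontier P \<inter> - K)"
      using connected_frontier_Int_cone[OF P p, of "- K"] by blast
    moreover have "x = p + 1 *\<^sub>R (x - p) + 0 *\<^sub>R (y - p)" "y = p + 0 *\<^sub>R (x - p) + 1 *\<^sub>R (y - p)"
      by simp_all
    then have "x \<in> K" "y \<in> K"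
      unfolding K_def by (metis (mono_tags, lifting) mem_Collect_eq zero_le_one order_refl)+
    ultimately show False
      using simple_closed_path_separation[OF g(1,2) t, of "frontier P \<inter> - K"] nK fr g(3) gt by auto
  qed
  then obtain z \<alpha> \<beta> where z: "z \<in> {a, c}" "0 \<le> \<alpha>" "0 \<le> \<beta>"
    "z = p + \<alpha> *\<^sub>R (x - p) + \<beta> *\<^sub>R (y - p)"
    unfolding K_def by blast
  have "1 \<le> \<alpha> + \<beta>"
  proof (rule ccontr)
    assume "\<not> 1 \<le> \<alpha> + \<beta>"
    then have lt: "\<alpha> + \<beta> < 1" by simp
    show False
    proof (cases "\<alpha> + \<beta> = 0")
      case True
      then have "z = p" using z by (auto simp: add_nonneg_eq_0_iff)
      then show False using p fr z(1) by (auto simp: frontier_def)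
    next
      case False
      \<comment> \<open>The point where the ray from \<open>p\<close> through \<open>z\<close> meets
        the chord; \<open>z\<close> lies strictly before it.\<close>
      define q where "q = (\<alpha> / (\<alpha> + \<beta>)) *\<^sub>R x + (\<beta> / (\<alpha> + \<beta>)) *\<^sub>R y"
      have "q \<in> P" unfolding q_def using z False inP fr
        by (intro convexD[OF P(1)]) (auto simp: add_divide_distrib[symmetric])
      have "(\<alpha> + \<beta>) *\<^sub>R q = \<alpha> *\<^sub>R x + \<beta> *\<^sub>R y"
        unfolding q_def using False by (simp add: scaleR_add_right)
      then have "z = q - (1 - (\<alpha> + \<beta>)) *\<^sub>R (q - p)"
        using z(4) by (simp add: algebra_simps)
      then have "z \<in> interior P"
        using mem_interior_convex_shrink[OF P(1) p \<open>q \<in> P\<close>, of "1 - (\<alpha> + \<beta>)"] lt z by simp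
      then show False using fr z by (auto simp: frontier_def)
    qed
  qed
  then show ?thesis using z by blast
qed

section \<open>Comparing distances to two sites\<close>

text \<open>The terms quadratic in \<open>x\<close> cancel, so the comparison of the two distances
  is governed by the sign of an affine function.\<close>

lemma dist_sq_diff:
  fixes x u v :: "'a::real_inner"
  shows "(dist x v)\<^sup>2 - (dist x u)\<^sup>2 = 2 * (x \<bullet> (u - v)) + v \<bullet> v - u \<bullet> u"
  unfolding dist_norm power2_norm_eq_inner by (simp add: inner_simps inner_commute)

lemma dist_sq_diff_affine:
  fixes x y u v :: "'a::real_inner"
  shows "(dist ((1 - t) *\<^sub>R x + t *\<^sub>R y) v)\<^sup>2 - (dist ((1 - t) *\<^sub>R x + t *\<^sub>R y) u)\<^sup>2 =
    (1 - t) * ((dist x v)\<^sup>2 - (dist x u)\<^sup>2) + t * ((dist y v)\<^sup>2 - (dist y u)\<^sup>2)"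
  unfolding dist_sq_diff by (simp add: inner_simps algebra_simps)

lemma dist_le_iff_sq: "dist x u \<le> dist x v \<longleftrightarrow> 0 \<le> (dist x v)\<^sup>2 - (dist x u)\<^sup>2"
  by (simp add: power_mono_iff)

lemma dist_less_iff_sq: "dist x u < dist x v \<longleftrightarrow> 0 < (dist x v)\<^sup>2 - (dist x u)\<^sup>2"
  using dist_le_iff_sq[of x v u] by (simp add: not_le[symmetric])

text \<open>The affine difference of squared distances is nonnegative at \<open>z\<close> and
  positive at \<open>u\<close>, hence positive on the segment without \<open>z\<close>.\<close>

lemma closer_on_segment:
  fixes u v z :: "'a::real_inner"
  assumes "dist z u \<le> dist z v" "u \<noteq> v" "y \<in> closed_segment z u" "y \<noteq> z"
  shows "dist y u < dist y v"
proof -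
  obtain t where t: "0 \<le> t" "t \<le> 1" "y = (1 - t) *\<^sub>R z + t *\<^sub>R u"
    using assms(3) unfolding in_segment by blast
  have "t > 0" using t assms(4) by (cases "t = 0") auto
  then have "0 < t * ((dist u v)\<^sup>2 - (dist u u)\<^sup>2)" using assms(2) by simp
  moreover have "0 \<le> (1 - t) * ((dist z v)\<^sup>2 - (dist z u)\<^sup>2)"
    using assms(1) t unfolding dist_le_iff_sq by simp
  ultimately show ?thesis
    unfolding dist_less_iff_sq t(3) dist_sq_diff_affine by linarith
qed

text \<open>The point \<open>v\<close> lies outside the disc with diameter \<open>u w\<close>, which contains the disc about \<open>y\<close>
  through the nearer of \<open>u\<close> and \<open>w\<close>.\<close>

lemma closer_on_opposite_side:
  fixes u v w :: "'a::real_inner"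
  assumes acute: "(u - v) \<bullet> (w - v) > 0" and "y \<in> closed_segment u w"
  shows "dist y u < dist y v \<or> dist y w < dist y v"
proof -
  have *: "dist z x < dist z v"
    if "(x - v) \<bullet> (x' - v) > 0" "0 \<le> t" "t \<le> 1/2" "z = (1 - t) *\<^sub>R x + t *\<^sub>R x'" for x x' z and t :: real
  proof -
    \<comment> \<open>For \<open>t\<close> at most 1/2 this is a convex combination of two positive
      numbers. The other half of the segment follows by exchanging its ends.\<close>
    have "(dist z v)\<^sup>2 - (dist z x)\<^sup>2 =
        (1 - 2 * t) * ((x - v) \<bullet> (x - v)) + 2 * t * ((x - v) \<bullet> (x' - v))"
      unfolding that(4) dist_sq_diff by (simp add: inner_simps inner_commute algebra_simps)
    moreover have "x - v \<noteq> 0" using that(1) by auto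
    then have "(x - v) \<bullet> (x - v) > 0" by simp
    then have "0 < (1 - 2 * t) * ((x - v) \<bullet> (x - v)) + 2 * t * ((x - v) \<bullet> (x' - v))"
      using that(1-3)
      by (cases "t = 0") (auto intro!: add_nonneg_pos)
    ultimately show ?thesis unfolding dist_less_iff_sq by simp
  qed
  obtain t where t: "0 \<le> t" "t \<le> 1" "y = (1 - t) *\<^sub>R u + t *\<^sub>R w"
    using assms(2) unfolding in_segment by blast
  show ?thesis
  proof (cases "t \<le> 1/2")
    case True
    then show ?thesis using *[OF acute t(1) True t(3)] by simp
  next
    case False
    then show ?thesis using *[of w u "1 - t" y] t acute by (simp add: inner_commute add.commute)
  qed
qed

section \<open>Sides of a line in the plane\<close>

text \<open>The planar cross product of \<open>y - x\<close> and \<open>z - x\<close>, twice the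
  signed area of the triangle \<open>x y z\<close>.\<close>

definition side :: "real^2 \<Rightarrow> real^2 \<Rightarrow> real^2 \<Rightarrow> real" where
  "side x y z = (y - x) $ 1 * (z - x) $ 2 - (y - x) $ 2 * (z - x) $ 1"

lemma side_affine: "side x y ((1 - t) *\<^sub>R p + t *\<^sub>R q) = (1 - t) * side x y p + t * side x y q"
  unfolding side_def by (simp add: algebra_simps)

text \<open>In barycentric form only the weight of \<open>p\<close> survives, since
  \<open>side x y\<close> vanishes at \<open>x\<close> and \<open>y\<close>. A coefficient sum above
  1 thus means crossing the line.\<close>

lemma side_cone:
  "side x y (p + \<alpha> *\<^sub>R (x - p) + \<beta> *\<^sub>R (y - p)) = (1 - (\<alpha> + \<beta>)) * side x y p"
  unfolding side_def by (simp add: algebra_simps)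

lemma continuous_on_side: "continuous_on S (side x y)"
  unfolding side_def by (intro continuous_intros)

lemma side_eq_0D:
  assumes "side x y z = 0" "x \<noteq> y"
  obtains t where "z = (1 - t) *\<^sub>R x + t *\<^sub>R y"
proof -
  have e: "(y$1 - x$1) * (z$2 - x$2) = (y$2 - x$2) * (z$1 - x$1)"
    using assms(1) by (simp add: side_def)
  have "y$1 - x$1 \<noteq> 0 \<or> y$2 - x$2 \<noteq> 0" using assms(2) by (auto simp: vec_eq_iff forall_2)
  then show thesis
  proof
    assume n: "y$1 - x$1 \<noteq> 0"
    define t where "t = (z$1 - x$1) / (y$1 - x$1)"
    have "t * (y$1 - x$1) = z$1 - x$1" "t * (y$2 - x$2) = z$2 - x$2"
      using n e by (simp_all add: t_def field_simps)
    then have "z = (1 - t) *\<^sub>R x + t *\<^sub>R y" by (simp add: vec_eq_iff forall_2 algebra_simps)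
    then show thesis by (rule that)
  next
    assume n: "y$2 - x$2 \<noteq> 0"
    define t where "t = (z$2 - x$2) / (y$2 - x$2)"
    have "t * (y$2 - x$2) = z$2 - x$2" "t * (y$1 - x$1) = z$1 - x$1"
      using n e by (simp_all add: t_def field_simps)
    then have "z = (1 - t) *\<^sub>R x + t *\<^sub>R y" by (simp add: vec_eq_iff forall_2 algebra_simps)
    then show thesis by (rule that)
  qed
qed

text \<open>The affine comparison function is nonpositive at both ends and nonnegative strictly
  between, so it vanishes at both ends. The line \<open>x y\<close> is then the bisector of
  \<open>u\<close> and \<open>v\<close>, and reflection in it exchanges them.\<close>

lemma bisector_separates:
  fixes u v x y z :: "real^2"
  assumes z: "z \<in> open_segment x y" and zu: "dist z u \<le> dist z v"
    and xv: "dist x v \<le> dist x u" and yv: "dist y v \<le> dist y u" and "u \<noteq> v"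
  shows "side x y u * side x y v < 0"
proof -
  define h where "h p = (dist p v)\<^sup>2 - (dist p u)\<^sup>2" for p
  obtain t where t: "0 < t" "t < 1" "z = (1 - t) *\<^sub>R x + t *\<^sub>R y" and xy: "x \<noteq> y"
    using z unfolding in_segment by blast
  have hx: "h x \<le> 0" using xv unfolding h_def dist_le_iff_sq by simp
  have hy: "h y \<le> 0" using yv unfolding h_def dist_le_iff_sq by simp
  have "0 \<le> (1 - t) * h x + t * h y"
    using zu unfolding dist_le_iff_sq t(3) dist_sq_diff_affine h_def .
  moreover have "(1 - t) * h x \<le> 0" "t * h y \<le> 0"
    using hx hy t by (simp_all add: mult_le_0_iff)
  ultimately have "(1 - t) * h x = 0" "t * h y = 0" by linarith+
  then have h0: "h x = 0" "h y = 0" using t by auto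
  define e where "e = u - v"
  define d where "d = y - x"
  \<comment> \<open>Twice the vector from \<open>x\<close> to the midpoint of \<open>u\<close> and
    \<open>v\<close>. Both \<open>d\<close> and \<open>m\<close> are orthogonal to \<open>e\<close>,
    hence parallel in the plane, and the two sides sum to 0.\<close>
  define m where "m = (u - x) + (v - x)"
  have "d \<bullet> e = 0" using h0 unfolding h_def dist_sq_diff d_def e_def by (simp add: inner_simps)
  then have de: "d$1 * e$1 + d$2 * e$2 = 0" by (simp add: inner_vec_def sum_2)
  have "m \<bullet> e = 0" using h0 unfolding h_def dist_sq_diff m_def e_def inner_add_left
    by (simp add: inner_simps inner_commute)
  then have me: "m$1 * e$1 + m$2 * e$2 = 0" by (simp add: inner_vec_def sum_2)
  have e0: "e$1 \<noteq> 0 \<or> e$2 \<noteq> 0" using \<open>u \<noteq> v\<close> by (auto simp: e_def vec_eq_iff forall_2)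
  have d0: "d$1 \<noteq> 0 \<or> d$2 \<noteq> 0" using xy by (auto simp: d_def vec_eq_iff forall_2)
  have "e$1 * (d$1 * m$2 - d$2 * m$1) = 0" "e$2 * (d$1 * m$2 - d$2 * m$1) = 0"
    using de me by algebra+
  then have "d$1 * m$2 - d$2 * m$1 = 0" using e0 by auto
  then have sum: "side x y u + side x y v = 0"
    unfolding side_def d_def m_def by (simp add: algebra_simps)
  \<comment> \<open>Lagrange's identity for orthogonal \<open>d\<close> and \<open>e\<close>; the
    cross product on the left is the difference of the two sides.\<close>
  have "(d$1 * e$2 - d$2 * e$1)\<^sup>2 = ((d$1)\<^sup>2 + (d$2)\<^sup>2) * ((e$1)\<^sup>2 + (e$2)\<^sup>2)"
    using de by algebra
  moreover have "(d$1)\<^sup>2 + (d$2)\<^sup>2 \<noteq> 0" "(e$1)\<^sup>2 + (e$2)\<^sup>2 \<noteq> 0"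
    using e0 d0 by (simp_all add: sum_power2_eq_zero_iff)
  ultimately have "d$1 * e$2 - d$2 * e$1 \<noteq> 0" by auto
  then have "side x y u - side x y v \<noteq> 0"
    unfolding side_def d_def e_def by (simp add: algebra_simps)
  with sum have "side x y v = - side x y u" "side x y u \<noteq> 0" by auto
  then show ?thesis by (metis mult_minus_right neg_less_0_iff_less not_real_square_gt_zero)
qed

section \<open>Chords through the interior and chords along an edge\<close>

text \<open>Moving a point of \<open>P\<close> towards an interior point enters the interior. The
  parameters range over all reals so that points of the line beyond \<open>x\<close> and
  \<open>y\<close> are covered.\<close>

lemma interior_on_line:
  fixes P :: "'a::euclidean_space set"
  assumes "convex P" "(1 - s) *\<^sub>R x + s *\<^sub>R y \<in> interior P" "(1 - r) *\<^sub>R x + r *\<^sub>R y \<in> P"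
    and "s < q \<and> q < r \<or> r < q \<and> q < s"
  shows "(1 - q) *\<^sub>R x + q *\<^sub>R y \<in> interior P"
proof -
  \<comment> \<open>The fraction of the way from \<open>r\<close> to \<open>s\<close> at which
    \<open>q\<close> lies.\<close>
  define e where "e = (r - q) / (r - s)"
  have e: "0 < e" "e \<le> 1" "e * (r - s) = r - q" using assms(4) by (auto simp: e_def field_simps)
  let ?L = "\<lambda>t. (1 - t) *\<^sub>R x + t *\<^sub>R y"
  have "?L r - e *\<^sub>R (?L r - ?L s) = ?L (r - e * (r - s))" by (simp add: algebra_simps)
  also have "\<dots> = ?L q" using e(3) by simp
  finally show ?thesis
    using mem_interior_convex_shrink[OF assms(1-3) e(1,2)] by simp
qed

text \<open>The alternative is whether the line \<open>x y\<close> meets the interior. If so,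
  interior points on both sides of it force \<open>a\<close> and \<open>c\<close> onto strictly
  opposite sides. If not, \<open>P\<close> lies on one side, and the point beyond the chord can only
  lie on the chord.\<close>

lemma cyclic_order_frontier_sides:
  fixes P :: "(real^2) set"
  assumes P: "convex P" "compact P" "interior P \<noteq> {}"
    and ord: "in_cyclic_order (frontier P) a x c y"
  shows "side x y a * side x y c < 0 \<and> (\<forall>z\<in>P. side x y z = 0 \<longrightarrow> z \<in> closed_segment x y) \<or>
    (a \<in> open_segment x y \<or> c \<in> open_segment x y) \<and> (\<forall>z\<in>P. \<forall>z'\<in>P. 0 \<le> side x y z * side x y z')"
proof -
  obtain g t1 t2 t3 t4 where g: "simple_path g" "path_image g = frontier P"
    and t: "0 \<le> t1" "t1 < t2" "t2 < t3" "t3 < t4" "t4 < 1"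
    and gt: "g t1 = a" "g t2 = x" "g t3 = c" "g t4 = y"
    using ord unfolding in_cyclic_order_def by blast
  have fr: "a \<in> frontier P" "x \<in> frontier P" "c \<in> frontier P" "y \<in> frontier P"
    using g(2) t gt unfolding path_image_def by force+
  have ne: "x \<noteq> y" "a \<noteq> x" "a \<noteq> y" "c \<noteq> x" "c \<noteq> y"
    using g(1) t gt unfolding simple_path_def loop_free_def by force+
  have nint: "z \<notin> interior P" if "z \<in> frontier P" for z using that by (simp add: frontier_def)
  have inP: "z \<in> P" if "z \<in> frontier P" for z
    using that P(2) by (metis compact_imp_closed frontier_subset_closed subsetD)
  have seg0: "side x y z = 0" if "z \<in> closed_segment x y" for z
    using that unfolding in_segment by (auto simp: side_affine) (auto simp: side_def)
  have beyond: "\<exists>z\<in>{a, c}. \<exists>\<alpha> \<beta>. 0 \<le> \<alpha> \<and> 0 \<le> \<beta> \<and> 1 \<le> \<alpha> + \<beta> \<and>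
    z = p + \<alpha> *\<^sub>R (x - p) + \<beta> *\<^sub>R (y - p)" if "p \<in> interior P" "side x y p \<noteq> 0" for p
    using cyclic_order_beyond_chord[OF P(1,2) that(1) _ ord] seg0 that(2) by blast
  have opp: "\<exists>z\<in>{a, c}. side x y z * side x y p \<le> 0"
    if pp: "p \<in> interior P" "side x y p \<noteq> 0" for p
  proof -
    obtain z \<alpha> \<beta> where z: "z \<in> {a, c}" "1 \<le> \<alpha> + \<beta>"
      "z = p + \<alpha> *\<^sub>R (x - p) + \<beta> *\<^sub>R (y - p)" using beyond[OF pp] by blast
    have "side x y z * side x y p = (1 - (\<alpha> + \<beta>)) * (side x y p * side x y p)"
      unfolding z(3) side_cone by simp
    also have "\<dots> \<le> 0" using z(2) by (simp add: mult_nonpos_nonneg)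
    finally show ?thesis using z(1) by blast
  qed
  show ?thesis
  proof (cases "\<exists>p\<in>interior P. side x y p = 0")
    case True
    then obtain p where p: "p \<in> interior P" "side x y p = 0" by blast
    obtain s where s: "p = (1 - s) *\<^sub>R x + s *\<^sub>R y" using side_eq_0D[OF p(2) ne(1)] .
    note line = interior_on_line[OF P(1) p(1)[unfolded s]]
    \<comment> \<open>Otherwise \<open>x\<close> or \<open>y\<close> would lie strictly between
      \<open>p\<close> and a point of \<open>P\<close>, or equal \<open>p\<close>, and be
      interior.\<close>
    have s01: "0 < s" "s < 1"
    proof -
      have "s \<noteq> 0" "s \<noteq> 1" using p(1) s nint fr by auto
      moreover have "\<not> s < 0" using line[of 1 0] nint fr inP by auto
      moreover have "\<not> s > 1" using line[of 0 1] nint fr inP by auto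
      ultimately show "0 < s" "s < 1" by linarith+
    qed
    have seg: "z \<in> closed_segment x y" if z: "z \<in> P" "side x y z = 0" for z
    proof -
      obtain r where r: "z = (1 - r) *\<^sub>R x + r *\<^sub>R y" using side_eq_0D[OF z(2) ne(1)] .
      have "\<not> r < 0" using line[of r 0] nint fr z s01 r by auto
      moreover have "\<not> r > 1" using line[of r 1] nint fr z s01 r by auto
      ultimately show ?thesis unfolding in_segment using r by (intro exI[of _ r]) auto
    qed
    have off: "side x y z \<noteq> 0" if z: "z \<in> frontier P" "z \<noteq> x" "z \<noteq> y" for z
    proof
      assume "side x y z = 0"
      then obtain r where r: "0 \<le> r" "r \<le> 1" "z = (1 - r) *\<^sub>R x + r *\<^sub>R y"
        using seg inP z unfolding in_segment by blast
      have "r \<noteq> 0" "r \<noteq> 1" "r \<noteq> s" using r z nint p s by auto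
      then have "0 < r" "r < 1" "r < s \<or> s < r" using r by auto
      then have "z \<in> interior P"
        using line[of 0 r] line[of 1 r] inP fr r(3) by auto
      then show False using nint z by blast
    qed
    obtain e where e: "e > 0" "ball p e \<subseteq> interior P"
      using p(1) open_interior open_contains_ball by blast
    \<comment> \<open>\<open>y - x\<close> turned by a right angle, so that moving from
      \<open>p\<close> along \<open>n\<close> changes the side at rate \<open>N > 0\<close>.\<close>
    define n :: "real^2" where "n = vector [- (y - x)$2, (y - x)$1]"
    have n: "n$1 = - (y - x)$2" "n$2 = (y - x)$1" by (simp_all add: n_def)
    define N where "N = ((y - x)$1)\<^sup>2 + ((y - x)$2)\<^sup>2"
    have d0: "(y - x)$1 \<noteq> 0 \<or> (y - x)$2 \<noteq> 0" using ne(1) by (auto simp: vec_eq_iff forall_2)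
    then have N: "N > 0" unfolding N_def by (simp only: sum_power2_gt_zero_iff)
    have sn: "side x y (p + k *\<^sub>R n) = k * N" for k
    proof -
      have "side x y (p + k *\<^sub>R n) = side x y p + k * ((y - x)$1 * n$2 - (y - x)$2 * n$1)"
        unfolding side_def by (simp add: algebra_simps)
      then show ?thesis unfolding n N_def p(2) by (simp add: power2_eq_square algebra_simps)
    qed
    have "n \<noteq> 0"
    proof
      assume "n = 0"
      then show False using d0 n by simp
    qed
    \<comment> \<open>Both \<open>p + k *\<^sub>R n\<close> and its mirror image stay within
      distance \<open>e / 2\<close> of \<open>p\<close>.\<close>
    define k where "k = e / (2 * norm n)"
    have k: "k > 0" using e \<open>n \<noteq> 0\<close> by (simp add: k_def)
    have "k * norm n < e" using e \<open>n \<noteq> 0\<close> by (simp add: k_def)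
    then have "p + k *\<^sub>R n \<in> interior P" "p + (- k) *\<^sub>R n \<in> interior P"
      using e(2) k by (auto simp: subset_iff dist_norm)
    from opp[OF this(1)] opp[OF this(2)]
    have "\<exists>z\<in>{a, c}. side x y z * (k * N) \<le> 0" "\<exists>z\<in>{a, c}. side x y z * (- k * N) \<le> 0"
      unfolding sn using k N by auto
    then have "\<exists>z\<in>{a, c}. side x y z \<le> 0" "\<exists>z\<in>{a, c}. side x y z \<ge> 0"
      using k N by (auto simp: mult_le_0_iff zero_le_mult_iff)
    then have "side x y a * side x y c < 0"
      using off[of a] off[of c] fr ne by (auto simp: mult_less_0_iff)
    then show ?thesis using seg by blast
  next
    case False
    obtain p where p: "p \<in> interior P" using P(3) by blast
    then have p0: "side x y p \<noteq> 0" using False by blast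
    have same: "0 \<le> side x y z * side x y p" if "z \<in> P" for z
    proof (rule ccontr)
      assume "\<not> 0 \<le> side x y z * side x y p"
      then have neg: "side x y z * side x y p < 0" by simp
      \<comment> \<open>The parameter at which the segment from \<open>p\<close> to \<open>z\<close>
        crosses the line; the crossing point would be interior.\<close>
      define t where "t = side x y p / (side x y p - side x y z)"
      have t: "0 < t" "t < 1" "(1 - t) * side x y p + t * side x y z = 0"
        using neg by (auto simp: t_def mult_less_0_iff field_simps)
      have "(1 - t) *\<^sub>R p + t *\<^sub>R z = z - (1 - t) *\<^sub>R (z - p)" by (simp add: algebra_simps)
      also have "\<dots> \<in> interior P"
        using t by (intro mem_interior_convex_shrink[OF P(1) p that]) auto
      finally show False using False t(3) side_affine by metis
    qed
    have sides: "0 \<le> side x y z * side x y z'" if "z \<in> P" "z' \<in> P" for z z'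
      using same[OF that(1)] same[OF that(2)] p0 by (auto simp: zero_le_mult_iff)
    obtain z \<alpha> \<beta> where z: "z \<in> {a, c}" "0 \<le> \<alpha>" "0 \<le> \<beta>" "1 \<le> \<alpha> + \<beta>"
      "z = p + \<alpha> *\<^sub>R (x - p) + \<beta> *\<^sub>R (y - p)" using beyond[OF p p0] by blast
    have "z \<in> P" using z(1) inP fr by auto
    \<comment> \<open>Lying on the same side as \<open>p\<close> bounds the coefficient sum by 1
      from above, so it equals 1.\<close>
    have "0 \<le> (1 - (\<alpha> + \<beta>)) * (side x y p * side x y p)"
      using same[OF \<open>z \<in> P\<close>] unfolding z(5) side_cone by (simp add: mult.assoc)
    moreover have "0 < side x y p * side x y p" using p0 by (metis not_real_square_gt_zero)
    ultimately have \<alpha>: "\<alpha> = 1 - \<beta>" using z(4) by (auto simp: zero_le_mult_iff)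
    have "z = (1 - \<beta>) *\<^sub>R x + \<beta> *\<^sub>R y" unfolding z(5) \<alpha> by (simp add: algebra_simps)
    then have "z \<in> closed_segment x y" using z(2,3) \<alpha> unfolding in_segment
      by (intro exI[of _ \<beta>]) auto
    then have "z \<in> open_segment x y" using z(1) ne unfolding open_segment_def by auto
    then show ?thesis using sides z(1) by blast
  qed
qed

section \<open>An acute angle contradicts the cyclic order\<close>

theorem lemma29:
  fixes P :: "(real ^ 2) set" and u v w a b\<^sub>1 c b\<^sub>2 :: "real ^ 2"
  assumes "convex_polygon P"
    and "u \<in> P" and "v \<in> P" and "w \<in> P"
    and "u \<noteq> v" and "v \<noteq> w" and "u \<noteq> w"
    and "a \<in> frontier P" and "b\<^sub>1 \<in> frontier P" and "c \<in> frontier P" and "b\<^sub>2 \<in> frontier P"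
    and "in_cyclic_order (frontier P) a b\<^sub>1 c b\<^sub>2"
    and "a \<in> Vor {u, v, w} u"
    and "b\<^sub>1 \<in> Vor {u, v, w} v" and "b\<^sub>2 \<in> Vor {u, v, w} v"
    and "c \<in> Vor {u, v, w} w"
  shows "angle u v w \<ge> pi / 2"
proof -
  have P: "convex P" "compact P" "interior P \<noteq> {}"
    using assms(1) by (auto simp: convex_polygon_def polytope_imp_convex polytope_imp_compact)
  have da: "dist a u \<le> dist a v" and dc: "dist c w \<le> dist c v"
    and db: "dist b\<^sub>1 v \<le> dist b\<^sub>1 u" "dist b\<^sub>2 v \<le> dist b\<^sub>2 u"
      "dist b\<^sub>1 v \<le> dist b\<^sub>1 w" "dist b\<^sub>2 v \<le> dist b\<^sub>2 w"
    using assms(13-16) by (auto simp: Vor_def not_less)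
  have "(u - v) \<bullet> (w - v) \<le> 0"
  proof (rule ccontr)
    assume "\<not> (u - v) \<bullet> (w - v) \<le> 0"
    then have acute: "(u - v) \<bullet> (w - v) > 0" by simp
    from cyclic_order_frontier_sides[OF P assms(12)] show False
    proof (elim disjE conjE)
      assume opp: "side b\<^sub>1 b\<^sub>2 a * side b\<^sub>1 b\<^sub>2 c < 0"
        and chord: "\<forall>z\<in>P. side b\<^sub>1 b\<^sub>2 z = 0 \<longrightarrow> z \<in> closed_segment b\<^sub>1 b\<^sub>2"
      define L where "L = closed_segment a u \<union> closed_segment u w \<union> closed_segment c w"
      have "connected L" unfolding L_def
        by (intro connected_Un) auto
      then have "connected (side b\<^sub>1 b\<^sub>2 ` L)"
        using continuous_on_side by (intro connected_continuous_image)
      moreover have "side b\<^sub>1 b\<^sub>2 a \<in> side b\<^sub>1 b\<^sub>2 ` L" "side b\<^sub>1 b\<^sub>2 c \<in> side b\<^sub>1 b\<^sub>2 ` L"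
        by (auto simp: L_def)
      moreover have "side b\<^sub>1 b\<^sub>2 a \<le> 0 \<and> 0 \<le> side b\<^sub>1 b\<^sub>2 c \<or> side b\<^sub>1 b\<^sub>2 c \<le> 0 \<and> 0 \<le> side b\<^sub>1 b\<^sub>2 a"
        using opp by (auto simp: mult_less_0_iff)
      ultimately have "0 \<in> side b\<^sub>1 b\<^sub>2 ` L" using connectedD_interval by metis
      then obtain z where z: "z \<in> L" "side b\<^sub>1 b\<^sub>2 z = 0" by force
      have "a \<in> P" "c \<in> P"
        using assms(8,10) P(2) by (metis compact_imp_closed frontier_subset_closed subsetD)+
      then have "L \<subseteq> P" unfolding L_def
        using assms(2,4) P(1) by (simp add: closed_segment_subset)
      then have "z \<in> closed_segment b\<^sub>1 b\<^sub>2" using z chord by blast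
      then obtain t where t: "0 \<le> t" "t \<le> 1" "z = (1 - t) *\<^sub>R b\<^sub>1 + t *\<^sub>R b\<^sub>2"
        unfolding in_segment by blast
      have "dist z v \<le> dist z u" "dist z v \<le> dist z w"
        using t db unfolding dist_le_iff_sq t(3) dist_sq_diff_affine by simp_all
      \<comment> \<open>The strict comparison along \<open>a u\<close> and \<open>c w\<close> fails
        only at \<open>a\<close> and \<open>c\<close>, which lie off the line of the chord.\<close>
      moreover have "z \<noteq> a" "z \<noteq> c" using z(2) opp by auto
      ultimately show False
        using z(1) closer_on_segment[OF da assms(5), of z] closer_on_opposite_side[OF acute, of z]
          closer_on_segment[OF dc, of z] assms(6) unfolding L_def by force
    next
      assume same: "\<forall>z\<in>P. \<forall>z'\<in>P. 0 \<le> side b\<^sub>1 b\<^sub>2 z * side b\<^sub>1 b\<^sub>2 z'"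
      {
        assume "a \<in> open_segment b\<^sub>1 b\<^sub>2"
        from bisector_separates[OF this da db(1,2) assms(5)] show False
          using same assms(2,3) by force
      next
        assume "c \<in> open_segment b\<^sub>1 b\<^sub>2"
        from bisector_separates[OF this dc db(3,4)] show False
          using same assms(3,4,6) by force
      }
    qed
  qed
  then have "((u - v) \<bullet> (w - v)) / (norm (u - v) * norm (w - v)) \<le> 0"
    by (simp add: divide_nonpos_nonneg)
  \<comment> \<open>Monotonicity of \<open>arccos\<close> is available only on the interval from -1
    to 1.\<close>
  moreover have "- 1 \<le> ((u - v) \<bullet> (w - v)) / (norm (u - v) * norm (w - v))"
    using Cauchy_Schwarz_ineq2[of "u - v" "w - v"] assms(5,6) by (simp add: field_simps abs_le_iff)
  ultimately have "arccos 0 \<le> angle u v w"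
    unfolding angle_def by (intro arccos_le_arccos) auto
  then show ?thesis by simp
qed

end
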